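(* Let $r$ be a positive integer and let $a,b>0$. Consider the algebraical polynomial based full-range composite Fourier series method over the domain $[-a,a]\times[-b,b]$, with its basis functions being the entries of $\mathbf{\Phi}_0$, $\mathbf{\Phi}_1$, $\mathbf{\Phi}_2$, $\mathbf{\Phi}_3$ as defined in the context. This method reproduces the two-dimensional complete algebraical polynomials of degree $2r$. That is, every polynomial $$\sum_{\substack{j,l\ge 0\\ j+l\le 2r}} c_{jl}\,\Big(\frac{x_1}{a}\Big)^{j}\Big(\frac{x_2}{b}\Big)^{l},\qquad c_{jl}\in\mathbb{R},$$ is, as a function on $[-a,a]\times[-b,b]$, a finite linear combination with real coefficients of the entries of $\mathbf{\Phi}_0,\mathbf{\Phi}_1,\mathbf{\Phi}_2,\mathbf{\Phi}_3$.
   Context: Notation: $f^{(k)}$ is the $k$-th derivative of a one-variable function, and $f^{(k_1,k_2)}=\partial^{k_1+k_2}f/\partial x_1^{k_1}\partial x_2^{k_2}$. Derivatives of vectors are taken entrywise. Put $\alpha_m=m\pi/a$ and $\beta_n=n\pi/b$. Put $\mu_0=1/2$ and $\mu_m=1$ for $m>0$. Put $\lambda_{00}=1/4$, $\lambda_{m0}=\lambda_{0n}=1/2$ for $m,n>0$, and $\lambda_{mn}=1$ for $m,n>0$. In the full-range composite Fourier series method, a function $u$ on $[-a,a]\times[-b,b]$ is expanded as $u=\mathbf{\Phi}_0^{T}\mathbf{q}_0+\mathbf{\Phi}_1^{T}\mathbf{q}_1+\mathbf{\Phi}_2^{T}\mathbf{q}_2+\mathbf{\Phi}_3^{T}\mathbf{q}_3$,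 with vectors of constants $\mathbf{q}_i$. The vectors of basis functions, for the algebraical polynomial based version with parameter $2r$, are the following. (0) Internal basis functions. The entries of $\mathbf{\Phi}_0$ are - $\lambda_{mn}\cos(\alpha_m x_1)\cos(\beta_n x_2)$ for $m,n\ge 0$; - $\lambda_{mn}\sin(\alpha_m x_1)\cos(\beta_n x_2)$ for $m\ge1$, $n\ge0$; - $\lambda_{mn}\cos(\alpha_m x_1)\sin(\beta_n x_2)$ for $m\ge0$, $n\ge1$; - $\lambda_{mn}\sin(\alpha_m x_1)\sin(\beta_n x_2)$ for $m,n\ge1$. (1) Boundary basis functions in the first direction. Let $\mathbf{p}_{1}^{T}(x_1)=[(x_1/a)^1,(x_1/a)^2,\dots,(x_1/a)^{2r}]$. Let $\mathbf{R}_{1}$ be the $2r\times 2r$ matrix whose rows are $\mathbf{p}_{1}^{(k)T}(a)-\mathbf{p}_{1}^{(k)T}(-a)$, $k=0,1,\dots,2r-1$. The entries of $\mathbf{\Phi}_1$ are all entries of the row vectors $\mu_n\cos(\beta_n x_2)\,\mathbf{p}_{1}^{T}(x_1)\mathbf{R}_{1}^{-1}$ for $n\ge0$, and $\mu_n\sin(\beta_n x_2)\,\mathbf{p}_{1}^{T}(x_1)\mathbf{R}_{1}^{-1}$ for $n\ge1$. (2) Boundary basis functions in the second direction. Let $\mathbf{p}_{2}^{T}(x_2)=[(x_2/b)^1,\dots,(x_2/b)^{2r}]$. Let $\mathbf{R}_2$ be the $2r\times2r$ matrix whose rows are $\mathbf{p}_{2}^{(k)T}(b)-\mathbf{p}_{2}^{(k)T}(-b)$,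 $k=0,\dots,2r-1$. The entries of $\mathbf{\Phi}_2$ are all entries of $\mu_m\cos(\alpha_m x_1)\,\mathbf{p}_{2}^{T}(x_2)\mathbf{R}_2^{-1}$ for $m\ge0$, and $\mu_m\sin(\alpha_m x_1)\,\mathbf{p}_{2}^{T}(x_2)\mathbf{R}_2^{-1}$ for $m\ge1$. (3) Corner basis functions. Let $\mathbf{p}_3^{T}(x_1,x_2)$ be the row vector (in any fixed order) of the following functions, where $j,l\ge0$ are integers: - $(x_1/a)^{2j+2}(x_2/b)^{2l+2}$ with $j+l\le r-2$; - $(x_1/a)^{2j+1}(x_2/b)^{2l+2}$ with $j+l\le r-2$; - $(x_1/a)^{2j+2}(x_2/b)^{2l+1}$ with $j+l\le r-2$; - $(x_1/a)^{2j+1}(x_2/b)^{2l+1}$ with $j+l\le r-1$. Let $\mathbf{R}_3$ be the square matrix whose rows, indexed (in any fixed order) by pairs of integers $k_1,k_2\ge0$ with $k_1+k_2\le 2r-2$, are $$\mathbf{p}_3^{(k_1,k_2)T}(a,b)-\mathbf{p}_3^{(k_1,k_2)T}(a,-b)-\mathbf{p}_3^{(k_1,k_2)T}(-a,b)+\mathbf{p}_3^{(k_1,k_2)T}(-a,-b).$$ The entries of $\mathbf{\Phi}_3$ are the entries of $\mathbf{p}_3^{T}(x_1,x_2)\mathbf{R}_3^{-1}$. The matrices $\mathbf{R}_1,\mathbf{R}_2,\mathbf{R}_3$ are invertible for these choices of functions, so the basis functions are well defined. *)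

theory Defs
  imports
    "HOL-Analysis.Derivative"
    "Jordan_Normal_Form.Gauss_Jordan_Elimination"
begin

text \<open>Entrywise derivatives of vector-valued functions of one and of two real variables. The
  functions differentiated below are polynomials, so the order of the partial derivatives is
  immaterial.\<close>

definition vec_deriv :: "nat \<Rightarrow> (real \<Rightarrow> real vec) \<Rightarrow> real \<Rightarrow> real vec" where
  "vec_deriv k p x = vec (dim_vec (p x)) (\<lambda>i. (deriv ^^ k) (\<lambda>t. p t $ i) x)"

definition partial_deriv :: "nat \<Rightarrow> nat \<Rightarrow> (real \<Rightarrow> real \<Rightarrow> real) \<Rightarrow> real \<Rightarrow> real \<Rightarrow> real" where
  "partial_deriv k1 k2 f x1 x2 = (deriv ^^ k1) (\<lambda>s. (deriv ^^ k2) (\<lambda>t. f s t) x2) x1"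

definition vec_partial_deriv ::
    "nat \<Rightarrow> nat \<Rightarrow> (real \<Rightarrow> real \<Rightarrow> real vec) \<Rightarrow> real \<Rightarrow> real \<Rightarrow> real vec" where
  "vec_partial_deriv k1 k2 p x1 x2 =
     vec (dim_vec (p x1 x2)) (\<lambda>i. partial_deriv k1 k2 (\<lambda>s t. p s t $ i) x1 x2)"

text \<open>The inverse matrix; \<^const>\<open>mat_inverse\<close> returns \<^const>\<open>None\<close> exactly on non-invertible
  matrices, so the value is meaningful only for invertible ones.\<close>

definition inv_mat :: "real mat \<Rightarrow> real mat" where
  "inv_mat R = the (mat_inverse R)"

definition freq :: "real \<Rightarrow> nat \<Rightarrow> real" where
  "freq c m = real m * pi / c"

definition mu :: "nat \<Rightarrow> real" where
  "mu m = (if m = 0 then 1 / 2 else 1)"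

definition lam :: "nat \<Rightarrow> nat \<Rightarrow> real" where
  "lam m n = (if m = 0 \<and> n = 0 then 1 / 4 else if m = 0 \<or> n = 0 then 1 / 2 else 1)"

definition Phi0 :: "real \<Rightarrow> real \<Rightarrow> (real \<Rightarrow> real \<Rightarrow> real) set" where
  "Phi0 a b =
     {(\<lambda>x1 x2. lam m n * cos (freq a m * x1) * cos (freq b n * x2)) | m n. m \<ge> 0 \<and> n \<ge> 0}
   \<union> {(\<lambda>x1 x2. lam m n * sin (freq a m * x1) * cos (freq b n * x2)) | m n. m \<ge> 1 \<and> n \<ge> 0}
   \<union> {(\<lambda>x1 x2. lam m n * cos (freq a m * x1) * sin (freq b n * x2)) | m n. m \<ge> 0 \<and> n \<ge> 1}
   \<union> {(\<lambda>x1 x2. lam m n * sin (freq a m * x1) * sin (freq b n * x2)) | m n. m \<ge> 1 \<and> n \<ge> 1}"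

text \<open>The polynomial vector, the jump matrix and the resulting row vector are the same in both
  directions, up to the half-length \<open>c\<close> of the interval (\<open>c = a\<close> for the first direction, \<open>c = b\<close>
  for the second). Vectors are indexed from 0, so entry \<open>i\<close> carries the power \<open>i + 1\<close>.\<close>

definition boundary_poly :: "nat \<Rightarrow> real \<Rightarrow> real \<Rightarrow> real vec" where
  "boundary_poly r c x = vec (2 * r) (\<lambda>i. (x / c) ^ (i + 1))"

definition boundary_mat :: "nat \<Rightarrow> real \<Rightarrow> real mat" where
  "boundary_mat r c = mat_of_rows (2 * r)
     (map (\<lambda>k. vec_deriv k (boundary_poly r c) c - vec_deriv k (boundary_poly r c) (- c))
       [0..<2 * r])"

definition boundary_row :: "nat \<Rightarrow> real \<Rightarrow> real \<Rightarrow> real mat" where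
  "boundary_row r c x = mat_of_row (boundary_poly r c x) * inv_mat (boundary_mat r c)"

definition Phi1 :: "nat \<Rightarrow> real \<Rightarrow> real \<Rightarrow> (real \<Rightarrow> real \<Rightarrow> real) set" where
  "Phi1 r a b =
     {(\<lambda>x1 x2. mu n * cos (freq b n * x2) * boundary_row r a x1 $$ (0, i)) | n i. n \<ge> 0 \<and> i < 2 * r}
   \<union> {(\<lambda>x1 x2. mu n * sin (freq b n * x2) * boundary_row r a x1 $$ (0, i)) | n i. n \<ge> 1 \<and> i < 2 * r}"

definition Phi2 :: "nat \<Rightarrow> real \<Rightarrow> real \<Rightarrow> (real \<Rightarrow> real \<Rightarrow> real) set" where
  "Phi2 r a b =
     {(\<lambda>x1 x2. mu m * cos (freq a m * x1) * boundary_row r b x2 $$ (0, i)) | m i. m \<ge> 0 \<and> i < 2 * r}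
   \<union> {(\<lambda>x1 x2. mu m * sin (freq a m * x1) * boundary_row r b x2 $$ (0, i)) | m i. m \<ge> 1 \<and> i < 2 * r}"

text \<open>Exponents of the corner monomials and orders of the corner derivatives. The constraints
  \<open>j + l \<le> r - 2\<close>, \<open>j + l \<le> r - 1\<close> and \<open>k1 + k2 \<le> 2 r - 2\<close> are written additively because
  subtraction on \<^typ>\<open>nat\<close> truncates; for \<open>r = 1\<close> the first one is unsatisfiable.\<close>

definition corner_exponents :: "nat \<Rightarrow> (nat \<times> nat) set" where
  "corner_exponents r =
     {(2 * j + 2, 2 * l + 2) | j l. j + l + 2 \<le> r}
   \<union> {(2 * j + 1, 2 * l + 2) | j l. j + l + 2 \<le> r}
   \<union> {(2 * j + 2, 2 * l + 1) | j l. j + l + 2 \<le> r}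
   \<union> {(2 * j + 1, 2 * l + 1) | j l. j + l + 1 \<le> r}"

definition corner_orders :: "nat \<Rightarrow> (nat \<times> nat) set" where
  "corner_orders r = {(k1, k2). k1 + k2 + 2 \<le> 2 * r}"

text \<open>The lists \<open>ps\<close> and \<open>ks\<close> fix the order of the corner monomials and of the rows of the corner
  matrix: they are meant to enumerate \<^term>\<open>corner_exponents r\<close> and \<^term>\<open>corner_orders r\<close>
  without repetition.\<close>

definition corner_poly :: "(nat \<times> nat) list \<Rightarrow> real \<Rightarrow> real \<Rightarrow> real \<Rightarrow> real \<Rightarrow> real vec" where
  "corner_poly ps a b x1 x2 = vec_of_list (map (\<lambda>(i, j). (x1 / a) ^ i * (x2 / b) ^ j) ps)"

definition corner_mat ::
    "(nat \<times> nat) list \<Rightarrow> (nat \<times> nat) list \<Rightarrow> real \<Rightarrow> real \<Rightarrow> real mat" where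
  "corner_mat ps ks a b = mat_of_rows (length ps)
     (map (\<lambda>(k1, k2).
         vec_partial_deriv k1 k2 (corner_poly ps a b) a b
       - vec_partial_deriv k1 k2 (corner_poly ps a b) a (- b)
       - vec_partial_deriv k1 k2 (corner_poly ps a b) (- a) b
       + vec_partial_deriv k1 k2 (corner_poly ps a b) (- a) (- b)) ks)"

definition corner_row ::
    "(nat \<times> nat) list \<Rightarrow> (nat \<times> nat) list \<Rightarrow> real \<Rightarrow> real \<Rightarrow> real \<Rightarrow> real \<Rightarrow> real mat" where
  "corner_row ps ks a b x1 x2 =
     mat_of_row (corner_poly ps a b x1 x2) * inv_mat (corner_mat ps ks a b)"

definition Phi3 ::
    "(nat \<times> nat) list \<Rightarrow> (nat \<times> nat) list \<Rightarrow> real \<Rightarrow> real \<Rightarrow> (real \<Rightarrow> real \<Rightarrow> real) set" where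
  "Phi3 ps ks a b = {(\<lambda>x1 x2. corner_row ps ks a b x1 x2 $$ (0, i)) | i. i < length ps}"

end

theory Submission
  imports Defs "Jordan_Normal_Form.Determinant" "HOL-Library.Function_Algebras"
begin

text \<open>The jump from \<open>-c\<close> to \<open>c\<close> of the \<open>k\<close>-th derivative of \<open>(x / c)\<^sup>n\<close> vanishes unless \<open>k < n\<close> and is
  nonzero for \<open>n = k + 1\<close>. Hence each boundary matrix is triangular with nonzero diagonal. The entries
  of the corner matrix are products of two such jumps, and the corner exponents are exactly the corner
  orders shifted by \<open>(1, 1)\<close>; ordering them by total degree makes this matrix triangular too. So all
  matrices are invertible, and \<open>p\<^sup>T = (p\<^sup>T R\<^sup>-\<^sup>1) R\<close> recovers the monomials from the basis
  functions: the corner functions yield \<open>x\<^sub>1\<^sup>i x\<^sub>2\<^sup>j\<close> with \<open>i, j \<ge> 1\<close>, the boundary functions of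
  frequency 0 the pure powers, and the internal function of frequency (0, 0) the constants.\<close>

unbundle no vec_syntax

section \<open>Spans of real functions of two variables\<close>

lemma sum_apply2: "(\<Sum>i\<in>A. f i) x y = (\<Sum>i\<in>A. f i x y)"
  for f :: "'i \<Rightarrow> 'a \<Rightarrow> 'b \<Rightarrow> 'c::comm_monoid_add"
  by (induction A rule: infinite_finite_induct) auto

interpretation fun2: Modules.module "\<lambda>(k::real) f (x::real) (y::real). k * f x y :: real"
  by unfold_locales (auto simp: fun_eq_iff algebra_simps)

lemma span_sum_scale:
  assumes "\<And>i. i \<in> A \<Longrightarrow> f i \<in> fun2.span S"
  shows "(\<lambda>x y. \<Sum>i\<in>A. k i * f i x y) \<in> fun2.span S"
proof -
  have "(\<lambda>x y. \<Sum>i\<in>A. k i * f i x y) = (\<Sum>i\<in>A. (\<lambda>x y. k i * f i x y))"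
    by (simp add: fun_eq_iff sum_apply2)
  then show ?thesis
    using assms by (auto intro!: fun2.span_sum fun2.span_scale)
qed

text \<open>Bridge from closure arguments in the span to the explicit form with a finite set and
  coefficients indexed by the functions themselves.\<close>

lemma in_span_iff:
  "f \<in> fun2.span S \<longleftrightarrow>
    (\<exists>F q. finite F \<and> F \<subseteq> S \<and> (\<forall>x y. f x y = (\<Sum>\<phi>\<in>F. q \<phi> * \<phi> x y)))"
  unfolding fun2.span_explicit by (auto simp: fun_eq_iff sum_apply2)

section \<open>Jumps of derivatives of monomials\<close>

text \<open>The product is a falling factorial; for \<open>k > n\<close> it contains the factor
  \<open>n - n\<close>, so the truncated exponent \<open>n - k\<close> does no harm. The constant
  \<open>d\<close> later absorbs the other variable in mixed derivatives.\<close>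

lemma higher_deriv_monomial:
  "(deriv ^^ k) (\<lambda>x::real. d * (x / c) ^ n) =
    (\<lambda>x. d * (\<Prod>i<k. real (n - i)) / c ^ k * (x / c) ^ (n - k))"
proof (induction k)
  case (Suc k)
  have "((\<lambda>x. d * (\<Prod>i<k. real (n - i)) / c ^ k * (x / c) ^ (n - k)) has_real_derivative
      d * (\<Prod>i<Suc k. real (n - i)) / c ^ Suc k * (x / c) ^ (n - Suc k)) (at x)" for x
    by (cases "c = 0") (auto intro!: derivative_eq_intros simp: power_0_left)
  then have "deriv (\<lambda>x. d * (\<Prod>i<k. real (n - i)) / c ^ k * (x / c) ^ (n - k)) =
      (\<lambda>x. d * (\<Prod>i<Suc k. real (n - i)) / c ^ Suc k * (x / c) ^ (n - Suc k))"
    by (intro ext DERIV_imp_deriv)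
  then show ?case
    by (simp add: Suc)
qed simp

definition monomial_jump :: "real \<Rightarrow> nat \<Rightarrow> nat \<Rightarrow> real" where
  "monomial_jump c k n = (deriv ^^ k) (\<lambda>x. (x / c) ^ n) c - (deriv ^^ k) (\<lambda>x. (x / c) ^ n) (- c)"

lemma monomial_jump_eq:
  assumes "c \<noteq> 0"
  shows "monomial_jump c k n = (\<Prod>i<k. real (n - i)) / c ^ k * (1 - (-1) ^ (n - k))"
  using higher_deriv_monomial[of k 1 c n] assms
  by (simp add: monomial_jump_def right_diff_distrib diff_divide_distrib)

text \<open>If \<open>k \<ge> n\<close>, the truncated \<open>n - k\<close> is 0 and the parity
  factor 1 - (-1)^0 vanishes.\<close>

lemma monomial_jump_neq_0_imp:
  assumes "c \<noteq> 0" "monomial_jump c k n \<noteq> 0"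
  shows "k < n"
proof (rule ccontr)
  assume "\<not> k < n"
  then show False
    using assms by (simp add: monomial_jump_eq)
qed

text \<open>Here \<open>n - k\<close> is 1, so the parity factor is 2, and the falling factorial has
  positive factors only.\<close>

lemma monomial_jump_Suc_neq_0:
  assumes "c \<noteq> 0"
  shows "monomial_jump c k (Suc k) \<noteq> 0"
  using assms by (auto simp: monomial_jump_eq)

section \<open>Invertible matrices and expansion of row vectors\<close>

text \<open>Triangular up to permutations: the columns are ordered by the weight \<open>w\<close> and row \<open>\<sigma> i\<close> carries
  the diagonal entry of column \<open>i\<close>.\<close>

lemma det_nonzero_if_triangular:
  fixes A :: "'a::field mat" and w :: "nat \<Rightarrow> nat"
  assumes A: "A \<in> carrier_mat n n"
    and \<sigma>: "\<And>i. i < n \<Longrightarrow> \<sigma> i < n"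
    and diag: "\<And>i. i < n \<Longrightarrow> A $$ (\<sigma> i, i) \<noteq> 0"
    and tri: "\<And>i j. i < n \<Longrightarrow> j < n \<Longrightarrow> j \<noteq> i \<Longrightarrow> A $$ (\<sigma> i, j) \<noteq> 0 \<Longrightarrow> w i < w j"
  shows "det A \<noteq> 0"
proof
  assume "det A = 0"
  then obtain v where v: "v \<in> carrier_vec n" "v \<noteq> 0\<^sub>v n" "A *\<^sub>v v = 0\<^sub>v n"
    using det_0_iff_vec_prod_zero[OF A] by auto
  obtain M where M: "w i \<le> M" if "i < n" for i
    by (rule that[of "Max (w ` {..<n})"]) simp
  have v0: "v $ i = 0" if "i < n" for i
    using that
  \<comment> \<open>Induction from the heaviest columns downwards: once \<open>v\<close> vanishes
    there, row \<open>\<sigma> i\<close> of \<open>A v = 0\<close> keeps only its diagonal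
    term.\<close>
  proof (induction "M - w i" arbitrary: i rule: less_induct)
    case less
    have row: "A $$ (\<sigma> i, j) * v $ j = (if j = i then A $$ (\<sigma> i, i) * v $ i else 0)" if "j < n" for j
    proof (cases "j \<noteq> i \<and> A $$ (\<sigma> i, j) \<noteq> 0")
      case True
      then have "w i < w j"
        using tri less.prems that by blast
      then have "v $ j = 0"
        using less.hyps[of j] M[OF that] that by linarith
      then show ?thesis
        using True by simp
    qed auto
    have "(\<Sum>j<n. A $$ (\<sigma> i, j) * v $ j) =
        (\<Sum>j<n. if j = i then A $$ (\<sigma> i, i) * v $ i else 0)"
      by (intro sum.cong row) auto
    then have "(\<Sum>j<n. A $$ (\<sigma> i, j) * v $ j) = A $$ (\<sigma> i, i) * v $ i"
      using less.prems by simp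
    moreover have "(A *\<^sub>v v) $ \<sigma> i = (\<Sum>j<n. A $$ (\<sigma> i, j) * v $ j)"
      using A v(1) \<sigma>[OF less.prems] by (auto simp: scalar_prod_def atLeast0LessThan)
    ultimately show ?case
      using v(3) \<sigma>[OF less.prems] diag[OF less.prems] by simp
  qed
  have "v = 0\<^sub>v n"
    using v(1) v0 by (intro eq_vecI) auto
  with v(2) show False ..
qed

lemma mult_inv_mat_left:
  assumes A: "A \<in> carrier_mat n n" and "det A \<noteq> 0"
  shows "inv_mat A \<in> carrier_mat n n" "inv_mat A * A = 1\<^sub>m n"
proof -
  obtain B where "mat_inverse A = Some B"
    using det_non_zero_imp_unit[OF assms] mat_inverse(1)[OF A] by (metis option.exhaust)
  then show "inv_mat A \<in> carrier_mat n n" "inv_mat A * A = 1\<^sub>m n"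
    using mat_inverse(2)[OF A] by (auto simp: inv_mat_def)
qed

text \<open>Entry \<open>l\<close> of p = (p \<open>inv_mat A\<close>) \<open>A\<close>. The
  coefficients form column \<open>l\<close> of \<open>A\<close> and do not depend on
  \<open>p\<close>, so they stay constant when \<open>p\<close> varies with a point.\<close>

lemma row_mult_inv_mat_expansion:
  assumes A: "A \<in> carrier_mat n n" and "det A \<noteq> 0" and p: "p \<in> carrier_vec n" and "l < n"
  shows "p $ l = (\<Sum>i<n. A $$ (i, l) * (mat_of_row p * inv_mat A) $$ (0, i))"
proof -
  note inv = mult_inv_mat_left[OF assms(1,2)]
  have P: "mat_of_row p \<in> carrier_mat 1 n"
    using p by simp
  have "mat_of_row p = (mat_of_row p * inv_mat A) * A"
    using inv(2) P by (simp add: assoc_mult_mat[OF P inv(1) A] right_mult_one_mat)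
  then have "p $ l = ((mat_of_row p * inv_mat A) * A) $$ (0, l)"
    using p \<open>l < n\<close> by (metis carrier_vecD mat_of_row_index)
  also have "\<dots> = (\<Sum>i<n. A $$ (i, l) * (mat_of_row p * inv_mat A) $$ (0, i))"
    using inv(1) P A p \<open>l < n\<close>
    by (subst index_mult_mat) (auto simp: scalar_prod_def atLeast0LessThan mult.commute)
  finally show ?thesis .
qed

section \<open>Boundary functions\<close>

lemma boundary_mat_carrier: "boundary_mat r c \<in> carrier_mat (2 * r) (2 * r)"
  by (simp add: boundary_mat_def mat_of_rows_def)

lemma boundary_mat_index:
  assumes "k < 2 * r" "i < 2 * r"
  shows "boundary_mat r c $$ (k, i) = monomial_jump c k (Suc i)"
  using assms
  by (simp add: boundary_mat_def mat_of_rows_def vec_deriv_def boundary_poly_def monomial_jump_def)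

lemma det_boundary_mat:
  assumes "c \<noteq> 0"
  shows "det (boundary_mat r c) \<noteq> 0"
proof (rule det_nonzero_if_triangular[OF boundary_mat_carrier, where \<sigma> = id and w = id])
  show "id i < id j"
    if "i < 2 * r" "j < 2 * r" "j \<noteq> i" "boundary_mat r c $$ (id i, j) \<noteq> 0" for i j
    using that monomial_jump_neq_0_imp[OF assms, of i "Suc j"] by (simp add: boundary_mat_index)
qed (auto simp: boundary_mat_index monomial_jump_Suc_neq_0 assms)

lemma monomial_boundary_row:
  assumes "c \<noteq> 0" "j \<ge> 1" "j \<le> 2 * r"
  shows "\<exists>k. \<forall>x. (x / c) ^ j = (\<Sum>i<2 * r. k i * boundary_row r c x $$ (0, i))"
proof -
  have p: "boundary_poly r c x \<in> carrier_vec (2 * r)" for x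
    by (simp add: boundary_poly_def)
  \<comment> \<open>Entries are indexed from 0, so the power \<open>j\<close> sits at position
    \<open>j - 1\<close>.\<close>
  have j: "j - 1 < 2 * r" "Suc (j - 1) = j"
    using assms by auto
  have "boundary_poly r c x $ (j - 1) = (x / c) ^ j" for x
    using j by (simp add: boundary_poly_def del: power_Suc)
  then have "(x / c) ^ j =
      (\<Sum>i<2 * r. boundary_mat r c $$ (i, j - 1) * boundary_row r c x $$ (0, i))" for x
    using row_mult_inv_mat_expansion[OF boundary_mat_carrier det_boundary_mat[OF assms(1)] p j(1)]
    by (simp add: boundary_row_def)
  then show ?thesis
    by (intro exI allI)
qed

section \<open>Corner exponents and the corner matrix\<close>

text \<open>The four families are the parity classes of \<open>(i, j)\<close>. In the mixed classes
  \<open>i + j\<close> is odd, so the bound \<open>2 * r\<close> cannot be attained, whence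
  \<open>j + l + 2 \<le> r\<close> there.\<close>

lemma corner_exponents_eq: "corner_exponents r = {(i, j). 1 \<le> i \<and> 1 \<le> j \<and> i + j \<le> 2 * r}"
proof (intro equalityI subsetI)
  fix p assume "p \<in> {(i, j). 1 \<le> i \<and> 1 \<le> j \<and> i + j \<le> 2 * r}"
  then obtain i j where ij: "p = (i, j)" "1 \<le> i" "1 \<le> j" "i + j \<le> 2 * r"
    by auto
  have *: "(\<exists>k. n = 2 * k + 1) \<or> (\<exists>k. n = 2 * k + 2)" if "1 \<le> n" for n :: nat
    using that by presburger
  from *[OF ij(2)] *[OF ij(3)] show "p \<in> corner_exponents r"
    using ij unfolding corner_exponents_def by auto
qed (auto simp: corner_exponents_def)

lemma corner_orders_eq: "corner_orders r = (\<lambda>(i, j). (i - 1, j - 1)) ` corner_exponents r"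
proof (intro equalityI subsetI)
  fix p assume "p \<in> corner_orders r"
  then have "(fst p + 1, snd p + 1) \<in> corner_exponents r"
    by (auto simp: corner_orders_def corner_exponents_eq)
  then show "p \<in> (\<lambda>(i, j). (i - 1, j - 1)) ` corner_exponents r"
    by (rule rev_image_eqI) simp
qed (auto simp: corner_orders_def corner_exponents_eq)

text \<open>The shift is injective because corner exponents are positive. This count makes the
  corner matrix square.\<close>

lemma card_corner_orders: "card (corner_orders r) = card (corner_exponents r)"
  unfolding corner_orders_eq
  by (rule card_image) (auto simp: inj_on_def corner_exponents_eq)

lemma partial_deriv_monomial:
  "partial_deriv k1 k2 (\<lambda>s t. (s / a) ^ i * (t / b) ^ j) x1 x2 =
    (deriv ^^ k1) (\<lambda>s. (s / a) ^ i) x1 * (deriv ^^ k2) (\<lambda>t. (t / b) ^ j) x2"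
proof -
  define D where "D = (deriv ^^ k2) (\<lambda>t. (t / b) ^ j) x2"
  have "(deriv ^^ k2) (\<lambda>t. (s / a) ^ i * (t / b) ^ j) x2 = D * (s / a) ^ i" for s
    using higher_deriv_monomial[of k2 1 b j]
    by (simp add: higher_deriv_monomial D_def)
  moreover have "(deriv ^^ k1) (\<lambda>s. D * (s / a) ^ i) x1 = D * (deriv ^^ k1) (\<lambda>s. (s / a) ^ i) x1"
    using higher_deriv_monomial[of k1 1 a i] by (simp add: higher_deriv_monomial)
  ultimately show ?thesis
    by (simp add: partial_deriv_def D_def)
qed

lemma corner_poly_index:
  "m < length ps \<Longrightarrow>
    corner_poly ps a b x1 x2 $ m = (x1 / a) ^ fst (ps ! m) * (x2 / b) ^ snd (ps ! m)"
  by (simp add: corner_poly_def vec_of_list_index case_prod_unfold)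

lemma dim_corner_poly: "dim_vec (corner_poly ps a b x1 x2) = length ps"
  by (simp add: corner_poly_def)

lemma corner_mat_carrier: "corner_mat ps ks a b \<in> carrier_mat (length ks) (length ps)"
  by (simp add: corner_mat_def mat_of_rows_def)

text \<open>The signed sum over the four corners factorises since each monomial separates the
  variables.\<close>

lemma corner_mat_index:
  assumes "l < length ks" "m < length ps"
  shows "corner_mat ps ks a b $$ (l, m) =
    monomial_jump a (fst (ks ! l)) (fst (ps ! m)) * monomial_jump b (snd (ks ! l)) (snd (ps ! m))"
  using assms
  by (simp add: corner_mat_def mat_of_rows_def case_prod_unfold vec_partial_deriv_def
      dim_corner_poly corner_poly_index partial_deriv_monomial monomial_jump_def algebra_simps)

section \<open>Monomials in the span of the basis functions\<close>

context
  fixes r :: nat and a b :: real and ps ks :: "(nat \<times> nat) list"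
  assumes ab: "a \<noteq> 0" "b \<noteq> 0"
    and ps: "distinct ps" "set ps = corner_exponents r"
    and ks: "distinct ks" "set ks = corner_orders r"
begin

lemma length_ks: "length ks = length ps"
  using ps ks card_corner_orders by (metis distinct_card)

lemma det_corner_mat: "det (corner_mat ps ks a b) \<noteq> 0"
proof -
  \<comment> \<open>The two lists are ordered independently, so the row carrying the diagonal entry
    of column \<open>m\<close> has to be chosen.\<close>
  have "\<exists>l<length ks. ks ! l = (fst (ps ! m) - 1, snd (ps ! m) - 1)" if "m < length ps" for m
    using that nth_mem[OF that] ps(2) ks(2)
    by (auto simp: in_set_conv_nth[symmetric] corner_orders_eq case_prod_unfold image_iff)
  then obtain \<sigma> where \<sigma>: "\<sigma> m < length ps" "ks ! \<sigma> m = (fst (ps ! m) - 1, snd (ps ! m) - 1)"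
    if "m < length ps" for m
    unfolding length_ks by metis
  have pos: "1 \<le> fst (ps ! m)" "1 \<le> snd (ps ! m)" if "m < length ps" for m
    using nth_mem[OF that] ps(2) by (auto simp: corner_exponents_eq)
  show ?thesis
  proof (rule det_nonzero_if_triangular[where \<sigma> = \<sigma> and w = "\<lambda>m. fst (ps ! m) + snd (ps ! m)"])
    show "corner_mat ps ks a b \<in> carrier_mat (length ps) (length ps)"
      using corner_mat_carrier length_ks by metis
    show "\<sigma> m < length ps" if "m < length ps" for m
      using \<sigma>(1)[OF that] .
    show "corner_mat ps ks a b $$ (\<sigma> m, m) \<noteq> 0" if "m < length ps" for m
      using monomial_jump_Suc_neq_0[OF ab(1), of "fst (ps ! m) - 1"]
        monomial_jump_Suc_neq_0[OF ab(2), of "snd (ps ! m) - 1"] \<sigma>[OF that] pos[OF that] that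
      by (simp add: corner_mat_index length_ks)
    show "fst (ps ! m) + snd (ps ! m) < fst (ps ! m') + snd (ps ! m')"
      if "m < length ps" "m' < length ps" "m' \<noteq> m" "corner_mat ps ks a b $$ (\<sigma> m, m') \<noteq> 0"
      for m m'
    proof -
      have "fst (ps ! m) - 1 < fst (ps ! m')" "snd (ps ! m) - 1 < snd (ps ! m')"
        using that(4) \<sigma>[OF that(1)] that(2) monomial_jump_neq_0_imp[OF ab(1)]
          monomial_jump_neq_0_imp[OF ab(2)]
        by (auto simp: corner_mat_index length_ks)
      \<comment> \<open>Both exponents of column \<open>m'\<close> are at least those of column
        \<open>m\<close>; distinctness makes one inequality strict, so the total degree
        increases.\<close>
      moreover have "ps ! m \<noteq> ps ! m'"
        using that ps(1) nth_eq_iff_index_eq by blast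
      ultimately show ?thesis
        using pos[OF that(1)] by (cases "ps ! m"; cases "ps ! m'") auto
    qed
  qed
qed

lemma monomial_corner_row:
  assumes "(i, j) \<in> corner_exponents r"
  shows "\<exists>k. \<forall>x1 x2. (x1 / a) ^ i * (x2 / b) ^ j =
    (\<Sum>m<length ps. k m * corner_row ps ks a b x1 x2 $$ (0, m))"
proof -
  obtain l where l: "l < length ps" "ps ! l = (i, j)"
    using assms ps(2) by (metis in_set_conv_nth)
  have "corner_mat ps ks a b \<in> carrier_mat (length ps) (length ps)"
    using corner_mat_carrier length_ks by metis
  note expansion = row_mult_inv_mat_expansion[OF this det_corner_mat _ l(1)]
  have "(x1 / a) ^ i * (x2 / b) ^ j =
      (\<Sum>m<length ps. corner_mat ps ks a b $$ (m, l) * corner_row ps ks a b x1 x2 $$ (0, m))"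
    for x1 x2
  proof -
    have "(x1 / a) ^ i * (x2 / b) ^ j = corner_poly ps a b x1 x2 $ l"
      using l by (simp add: corner_poly_index)
    also have "\<dots> =
        (\<Sum>m<length ps. corner_mat ps ks a b $$ (m, l) * corner_row ps ks a b x1 x2 $$ (0, m))"
      unfolding corner_row_def
      by (rule expansion) (rule carrier_vecI, rule dim_corner_poly)
    finally show ?thesis .
  qed
  then show ?thesis
    by (intro exI allI)
qed

lemma monomial_in_span:
  assumes "i + j \<le> 2 * r"
  shows "(\<lambda>x1 x2. (x1 / a) ^ i * (x2 / b) ^ j) \<in>
    fun2.span (Phi0 a b \<union> Phi1 r a b \<union> Phi2 r a b \<union> Phi3 ps ks a b)" (is "_ \<in> fun2.span ?S")
proof -
  consider "i = 0" "j = 0" | "i \<ge> 1" "j = 0" | "i = 0" "j \<ge> 1" | "(i, j) \<in> corner_exponents r"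
    using assms by (force simp: corner_exponents_eq)
  then show ?thesis
  proof cases
    case 1
    have "(\<lambda>x1 x2. lam 0 0 * cos (freq a 0 * x1) * cos (freq b 0 * x2)) \<in> ?S"
      unfolding Phi0_def by (intro UnI1 CollectI exI[of _ 0]) simp
    \<comment> \<open>At frequency 0 the cosines are 1, and 4 cancels
      \<open>lam 0 0\<close>.\<close>
    from fun2.span_scale[OF fun2.span_base[OF this], of 4] show ?thesis
      using 1 by (simp add: lam_def freq_def)
  next
    case 2
    then obtain k where k: "\<And>x. (x / a) ^ i = (\<Sum>l<2 * r. k l * boundary_row r a x $$ (0, l))"
      using monomial_boundary_row[OF ab(1), of i r] assms by auto
    have base: "(\<lambda>x1 x2. mu 0 * cos (freq b 0 * x2) * boundary_row r a x1 $$ (0, l)) \<in> ?S"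
      if "l < 2 * r" for l
      using that unfolding Phi1_def
      by (intro UnI1 UnI2[of _ _ "Phi0 a b"] CollectI exI[of _ 0] exI[of _ l]) simp
    \<comment> \<open>The factor 2 cancels \<open>mu 0\<close>.\<close>
    have "(\<lambda>x1 x2. \<Sum>l<2 * r. (2 * k l) *
        (mu 0 * cos (freq b 0 * x2) * boundary_row r a x1 $$ (0, l))) \<in> fun2.span ?S"
      by (rule span_sum_scale, rule fun2.span_base, rule base) simp
    then show ?thesis
      using 2 by (simp add: k mu_def freq_def)
  next
    case 3
    then obtain k where k: "\<And>x. (x / b) ^ j = (\<Sum>l<2 * r. k l * boundary_row r b x $$ (0, l))"
      using monomial_boundary_row[OF ab(2), of j r] assms by auto
    have base: "(\<lambda>x1 x2. mu 0 * cos (freq a 0 * x1) * boundary_row r b x2 $$ (0, l)) \<in> ?S"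
      if "l < 2 * r" for l
      using that unfolding Phi2_def
      by (intro UnI1 UnI2[of _ _ "Phi0 a b \<union> Phi1 r a b"] CollectI exI[of _ 0] exI[of _ l]) simp
    have "(\<lambda>x1 x2. \<Sum>l<2 * r. (2 * k l) *
        (mu 0 * cos (freq a 0 * x1) * boundary_row r b x2 $$ (0, l))) \<in> fun2.span ?S"
      by (rule span_sum_scale, rule fun2.span_base, rule base) simp
    then show ?thesis
      using 3 by (simp add: k mu_def freq_def)
  next
    case 4
    from monomial_corner_row[OF this] obtain k where k:
      "\<And>x1 x2. (x1 / a) ^ i * (x2 / b) ^ j =
        (\<Sum>m<length ps. k m * corner_row ps ks a b x1 x2 $$ (0, m))"
      by auto
    have base: "(\<lambda>x1 x2. corner_row ps ks a b x1 x2 $$ (0, m)) \<in> ?S" if "m < length ps" for m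
      using that unfolding Phi3_def by (intro UnI2 CollectI exI[of _ m]) simp
    show ?thesis
      unfolding k by (rule span_sum_scale, rule fun2.span_base, rule base) simp
  qed
qed

end

theorem theoremA1:
  fixes r :: nat and a b :: real
    and ps ks :: "(nat \<times> nat) list"
    and c :: "nat \<Rightarrow> nat \<Rightarrow> real"
  assumes "r > 0" and "a > 0" and "b > 0"
    and "distinct ps" and "set ps = corner_exponents r"
    and "distinct ks" and "set ks = corner_orders r"
  shows "\<exists>(F :: (real \<Rightarrow> real \<Rightarrow> real) set) (q :: (real \<Rightarrow> real \<Rightarrow> real) \<Rightarrow> real).
    finite F \<and> F \<subseteq> Phi0 a b \<union> Phi1 r a b \<union> Phi2 r a b \<union> Phi3 ps ks a b \<and>
    (\<forall>x1\<in>{-a..a}. \<forall>x2\<in>{-b..b}.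
      (\<Sum>(j, l)\<in>{(j, l). j + l \<le> 2 * r}. c j l * (x1 / a) ^ j * (x2 / b) ^ l)
      = (\<Sum>\<phi>\<in>F. q \<phi> * \<phi> x1 x2))"
proof -
  have ab: "a \<noteq> 0" "b \<noteq> 0"
    using assms by auto
  have "(\<lambda>x1 x2. \<Sum>p\<in>{(j, l). j + l \<le> 2 * r}.
        c (fst p) (snd p) * ((x1 / a) ^ fst p * (x2 / b) ^ snd p))
      \<in> fun2.span (Phi0 a b \<union> Phi1 r a b \<union> Phi2 r a b \<union> Phi3 ps ks a b)"
    by (rule span_sum_scale) (auto intro: monomial_in_span[OF ab assms(4-7)])
  \<comment> \<open>The identity obtained holds on the whole plane, hence on the rectangle.\<close>
  then obtain F q where "finite F" "F \<subseteq> Phi0 a b \<union> Phi1 r a b \<union> Phi2 r a b \<union> Phi3 ps ks a b"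
    and eq: "\<And>x1 x2. (\<Sum>p\<in>{(j, l). j + l \<le> 2 * r}.
        c (fst p) (snd p) * ((x1 / a) ^ fst p * (x2 / b) ^ snd p)) = (\<Sum>\<phi>\<in>F. q \<phi> * \<phi> x1 x2)"
    unfolding in_span_iff by metis
  then show ?thesis
    by (intro exI[of _ F] exI[of _ q]) (simp add: case_prod_unfold mult.assoc flip: eq)
qed

end
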